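(* Let $G$ be a compact Hausdorff topological group with normalized Haar measure $\mathfrak{m}$. Let $n$ be a positive integer and suppose that $A_1,\dots,A_n$ are measurable subsets of $G$ with $\mathfrak{m}(A_i)>0$ for $i=1,\dots,n$. Then the map \[\Lambda: \underbrace{G\times\cdots\times G}_{n\text{ times}}\to\mathbb{R}^{\geq 0},\qquad (x_1,\dots,x_n)\mapsto \mathfrak{m}\big(x_1A_1\cap\cdots\cap x_nA_n\big)\] is non-zero (that is, not identically zero) and continuous. In particular, if $A$ is a measurable subset of $G$ with positive Haar measure, then for every positive integer $k$ there exists an open subset $U$ of $G$ containing the identity $1$ such that $\mathfrak{m}(A\cap u_1A\cap\cdots\cap u_kA)>0$ for all $u_1,\dots,u_k\in U$.
   Context: The normalized Haar measure $\mathfrak{m}=\mathfrak{m}_G$ of a compact Hausdorff group $G$ is the unique Haar measure with $\mathfrak{m}(G)=1$; measurable means measurable with respect to Haar measure. For $x\in G$ and $A\subseteq G$, $xA=\{xa : a\in A\}$. The product $G\times\cdots\times G$ carries the product topology. *)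

theory Defs
  imports "HOL-Analysis.Analysis" "HOL-Algebra.Coset"
begin

locale topological_group = group G
  for G :: "('a, 'b) monoid_scheme" (structure) and T :: "'a topology" +
  assumes topspace_eq_carrier: "topspace T = carrier G"
    and continuous_map_mult:
      "continuous_map (prod_topology T T) T (\<lambda>(x, y). x \<otimes> y)"
    and continuous_map_inv: "continuous_map T T (\<lambda>x. inv x)"

locale compact_Hausdorff_group = topological_group G T
  for G :: "('a, 'b) monoid_scheme" (structure) and T :: "'a topology" +
  assumes compact: "compact_space T"
    and Hausdorff: "Hausdorff_space T"

text \<open>
  A Haar measure is a nonzero left-invariant Radon measure, given here on the Borel sets only;
  the Haar measurable subsets are the members of \<^term>\<open>sets (completion M)\<close>. For a finite
  measure these are also the sets that are measurable in the sense of Caratheodory for the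
  induced outer measure. The side condition \<^term>\<open>K \<in> sets M\<close> on compact sets is automatic
  in a Hausdorff group.
\<close>

definition haar_measure ::
    "('a, 'b) monoid_scheme \<Rightarrow> 'a topology \<Rightarrow> 'a measure \<Rightarrow> bool" where
  "haar_measure G T M \<longleftrightarrow>
     space M = topspace T \<and>
     sets M = sigma_sets (topspace T) {U. openin T U} \<and>
     emeasure M (space M) \<noteq> 0 \<and>
     (\<forall>K. compactin T K \<and> K \<in> sets M \<longrightarrow> emeasure M K < \<infinity>) \<and>
     (\<forall>B \<in> sets M. emeasure M B = (INF U \<in> {U. openin T U \<and> B \<subseteq> U}. emeasure M U)) \<and>
     (\<forall>U. openin T U \<longrightarrow>
        emeasure M U = (SUP K \<in> {K. compactin T K \<and> K \<in> sets M \<and> K \<subseteq> U}. emeasure M K)) \<and>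
     (\<forall>x \<in> carrier G. \<forall>B \<in> sets M. emeasure M (x <#\<^bsub>G\<^esub> B) = emeasure M B)"

definition normalized_haar_measure ::
    "('a, 'b) monoid_scheme \<Rightarrow> 'a topology \<Rightarrow> 'a measure \<Rightarrow> bool" where
  "normalized_haar_measure G T M \<longleftrightarrow> haar_measure G T M \<and> emeasure M (space M) = 1"

end

theory Submission
  imports Defs
begin

text \<open>
  Regularity of the measure gives \<open>\<mu> (v A \<triangle> A) \<rightarrow> 0\<close> as \<open>v \<rightarrow> 1\<close>: squeeze \<open>A\<close> between a compact \<open>C\<close> and
  an open \<open>U\<close> and take \<open>v C \<subseteq> U\<close>. Continuity and the recurrence statement follow, since the
  measure of a finite intersection changes by at most the sum of the changes of its members.
  Non-vanishing follows by induction from the case of two sets: averaging over \<open>p\<close> shows that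
  \<open>\<mu> (B \<inter> p U) \<ge> \<mu> B * \<mu> (C\<^sup>-\<^sup>1)\<close> for some \<open>p\<close>; the choice of \<open>B\<close> as the whole group
  yields \<open>\<mu> (C\<^sup>-\<^sup>1) \<ge> \<mu> C\<close>, and then \<open>U\<close> shrinks to \<open>A\<close>.
\<close>

no_notation subset_mset (infix "<#" 50)

section \<open>Haar measure on the completed Borel sigma-algebra\<close>

locale normalized_haar_group = compact_Hausdorff_group G T
  for G :: "('a, 'b) monoid_scheme" (structure) and T :: "'a topology" +
  fixes M :: "'a measure"
  assumes normalized_haar: "normalized_haar_measure G T M"
begin

text \<open>The completion is used because the sets in question are Haar measurable, while
  \<open>M\<close> is given on Borel sets only.\<close>

abbreviation \<mu> :: "'a set \<Rightarrow> real" where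
  "\<mu> \<equiv> measure (completion M)"

lemma haar: "haar_measure G T M" and emeasure_space: "emeasure M (space M) = 1"
  using normalized_haar by (auto simp: normalized_haar_measure_def)

lemma space_M: "space M = carrier G"
  using haar by (simp add: haar_measure_def topspace_eq_carrier)

lemma sets_M: "sets M = sigma_sets (carrier G) {U. openin T U}"
  using haar by (simp add: haar_measure_def topspace_eq_carrier)

lemma openin_sets: "openin T U \<Longrightarrow> U \<in> sets M"
  by (simp add: sets_M sigma_sets.Basic)

lemma closedin_sets: "closedin T C \<Longrightarrow> C \<in> sets M"
  by (metis closedin_def openin_sets sets.Diff sets.top double_diff order_refl
      space_M topspace_eq_carrier)

sublocale finite_measure "completion M"
  by (rule finite_measureI) (simp add: emeasure_space)

lemma measure_space_1: "\<mu> (carrier G) = 1"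
  using emeasure_space by (simp add: space_M [symmetric] measure_def)

lemma sets_subset_carrier: "A \<in> sets (completion M) \<Longrightarrow> A \<subseteq> carrier G"
  using sets.sets_into_space space_M by fastforce

section \<open>Left translates: openness, measurability, invariance\<close>

text \<open>As the preimage under translation by \<open>inv x\<close>, a coset inherits openness,
  measurability and compatibility with set difference.\<close>

lemma l_coset_eq_vimage:
  assumes "x \<in> carrier G" "A \<subseteq> carrier G"
  shows "x <# A = {y \<in> carrier G. inv x \<otimes> y \<in> A}"
proof -
  have "y \<in> x <# A" if "y \<in> carrier G" "inv x \<otimes> y \<in> A" for y
  proof -
    have "y = x \<otimes> (inv x \<otimes> y)"
      using that assms by (simp add: m_assoc [symmetric])
    with that show ?thesis by (auto simp: l_coset_def)
  qed
  moreover have "y \<in> carrier G \<and> inv x \<otimes> y \<in> A" if "y \<in> x <# A" for y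
  proof -
    from that obtain a where "a \<in> A" "y = x \<otimes> a" by (auto simp: l_coset_def)
    with assms show ?thesis by (auto simp: m_assoc [symmetric])
  qed
  ultimately show ?thesis by blast
qed

lemma continuous_map_translate:
  assumes "x \<in> carrier G"
  shows "continuous_map T T (\<lambda>y. x \<otimes> y)"
proof -
  have "continuous_map T (prod_topology T T) (\<lambda>y. (x, y))"
    using assms by (simp add: continuous_map_pairedI topspace_eq_carrier)
  from continuous_map_compose [OF this continuous_map_mult] show ?thesis
    by (simp add: comp_def)
qed

lemma openin_l_coset:
  assumes "x \<in> carrier G" "openin T U"
  shows "openin T (x <# U)"
  using openin_continuous_map_preimage [OF continuous_map_translate, of "inv x" U] assms
    openin_subset [of T U]
  by (simp add: l_coset_eq_vimage topspace_eq_carrier)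

lemma l_coset_sets:
  assumes x: "x \<in> carrier G" and A: "A \<in> sets M"
  shows "x <# A \<in> sets M"
proof -
  have "(\<lambda>y. inv x \<otimes> y) \<in> measurable M M"
  proof (rule measurable_sigma_sets)
    show "sets M = sigma_sets (carrier G) {U. openin T U}" by (fact sets_M)
    show "{U. openin T U} \<subseteq> Pow (carrier G)"
      using openin_subset topspace_eq_carrier by blast
    show "(\<lambda>y. inv x \<otimes> y) \<in> space M \<rightarrow> carrier G"
      using x by (auto simp: space_M)
    show "(\<lambda>y. inv x \<otimes> y) -` U \<inter> space M \<in> sets M" if "U \<in> {U. openin T U}" for U
    proof -
      have "(\<lambda>y. inv x \<otimes> y) -` U \<inter> space M = x <# U"
        using that x openin_subset [of T U]
        by (auto simp: l_coset_eq_vimage space_M topspace_eq_carrier)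
      then show ?thesis using openin_l_coset [OF x] that openin_sets by simp
    qed
  qed
  from measurable_sets [OF this A] have "(\<lambda>y. inv x \<otimes> y) -` A \<inter> space M \<in> sets M" .
  moreover have "(\<lambda>y. inv x \<otimes> y) -` A \<inter> space M = x <# A"
    using x A sets.sets_into_space [OF A] by (auto simp: l_coset_eq_vimage space_M)
  ultimately show ?thesis by simp
qed

lemma emeasure_l_coset:
  "x \<in> carrier G \<Longrightarrow> A \<in> sets M \<Longrightarrow> emeasure M (x <# A) = emeasure M A"
  using haar by (simp add: haar_measure_def)

text \<open>Translation sends null Borel sets to null Borel sets, so a decomposition into a Borel
  set and a subset of a null set survives it, and only the Borel part carries measure.\<close>

lemma
  assumes x: "x \<in> carrier G" and A: "A \<in> sets (completion M)"
  shows l_coset_sets_completion: "x <# A \<in> sets (completion M)"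
    and measure_l_coset: "\<mu> (x <# A) = \<mu> A"
proof -
  obtain S N N' where S: "A = S \<union> N" "N \<subseteq> N'" "N' \<in> null_sets M" "S \<in> sets M"
    using A by (rule sets_completionE)
  have eq: "x <# A = (x <# S) \<union> (x <# N)" and sub: "x <# N \<subseteq> x <# N'"
    using S by (auto simp: l_coset_def)
  have null: "x <# N' \<in> null_sets M"
    using S x by (auto simp: null_sets_def l_coset_sets emeasure_l_coset)
  show *: "x <# A \<in> sets (completion M)"
    using eq sub null l_coset_sets [OF x S(4)] by (rule sets_completionI)
  have "emeasure (completion M) (B \<union> Z) = emeasure M B"
    if "B \<in> sets M" "Z \<subseteq> Z'" "Z' \<in> null_sets M" for B Z Z'
  proof -
    have "Z \<in> null_sets (completion M)"
      using that null_sets_completion_iff2 by blast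
    then show ?thesis using that by (simp add: emeasure_Un_null_set)
  qed
  then have "emeasure (completion M) (x <# A) = emeasure (completion M) A"
    using S eq sub null l_coset_sets [OF x S(4)] emeasure_l_coset [OF x S(4)] by metis
  then show "\<mu> (x <# A) = \<mu> A" by (simp add: measure_def)
qed

lemma l_coset_l_coset:
  "x \<in> carrier G \<Longrightarrow> y \<in> carrier G \<Longrightarrow> A \<subseteq> carrier G \<Longrightarrow> x <# (y <# A) = (x \<otimes> y) <# A"
  by (auto simp: l_coset_def m_assoc subset_iff)

section \<open>Regularity, and continuity of translation in measure\<close>

lemma outer_regular:
  assumes A: "A \<in> sets (completion M)" and e: "e > 0"
  obtains U where "openin T U" "A \<subseteq> U" "\<mu> U < \<mu> A + e"
proof -
  obtain S N N' where S: "A = S \<union> N" "N \<subseteq> N'" "N' \<in> null_sets M" "S \<in> sets M"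
    using A by (rule sets_completionE)
  \<comment> \<open>Enlarging the negligible part \<open>N\<close> to \<open>N'\<close> gives a
    Borel superset of \<open>A\<close> without raising the measure, so outer regularity on Borel
    sets applies.\<close>
  let ?B = "S \<union> N'"
  have B: "?B \<in> sets M" using S by auto
  have "emeasure M ?B = emeasure M S" using S by (simp add: emeasure_Un_null_set)
  then have "\<mu> ?B = \<mu> S" using S B by (simp add: measure_def)
  also have "\<dots> \<le> \<mu> A" using S A by (intro finite_measure_mono) auto
  finally have le: "\<mu> ?B \<le> \<mu> A" .
  have "emeasure M ?B = (INF U \<in> {U. openin T U \<and> ?B \<subseteq> U}. emeasure M U)"
    using haar B by (simp add: haar_measure_def)
  moreover have "emeasure M ?B < ennreal (\<mu> ?B + e)"
    using B e emeasure_eq_measure [of ?B] by (simp add: ennreal_less_iff)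
  ultimately obtain U where U: "openin T U" "?B \<subseteq> U" "emeasure M U < ennreal (\<mu> ?B + e)"
    by (auto simp: INF_less_iff)
  have "\<mu> U < \<mu> ?B + e"
    using U(3) openin_sets [OF U(1)] emeasure_eq_measure [of U]
    by (simp add: ennreal_less_iff)
  then show thesis using that [of U] U S le by auto
qed

text \<open>Outer regularity is applied to \<open>A\<close> and to its complement; the complement of
  the second open set is the closed set inside \<open>A\<close>.\<close>

lemma closed_open_approx:
  assumes A: "A \<in> sets (completion M)" and e: "e > 0"
  obtains C U where "closedin T C" "openin T U" "C \<subseteq> A" "A \<subseteq> U" "\<mu> (U - C) < e"
proof -
  obtain U where U: "openin T U" "A \<subseteq> U" "\<mu> U < \<mu> A + e/2"
    using outer_regular [OF A, of "e/2"] e by auto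
  have cA: "carrier G - A \<in> sets (completion M)"
    using A sets.compl_sets [OF A] by (simp add: space_M)
  obtain W where W: "openin T W" "carrier G - A \<subseteq> W" "\<mu> W < \<mu> (carrier G - A) + e/2"
    using outer_regular [OF cA, of "e/2"] e by auto
  let ?C = "carrier G - W"
  have sets: "U \<in> sets (completion M)" "W \<in> sets (completion M)"
    using U W openin_sets by auto
  \<comment> \<open>A point of \<open>U - ?C\<close> lies in both \<open>U\<close> and
    \<open>W\<close>: outside \<open>A\<close> it belongs to the excess of \<open>U\<close>, inside
    \<open>A\<close> to the excess of \<open>W\<close>. Each excess has measure below
    \<open>e/2\<close>.\<close>
  have "\<mu> (U - ?C) \<le> \<mu> ((U - A) \<union> (W - (carrier G - A)))"
    using sets A cA sets_subset_carrier [OF sets(1)] by (intro finite_measure_mono) auto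
  also have "\<dots> \<le> \<mu> (U - A) + \<mu> (W - (carrier G - A))"
    using sets A cA by (intro measure_Un_le) auto
  also have "\<dots> = (\<mu> U - \<mu> A) + (\<mu> W - \<mu> (carrier G - A))"
    using sets A cA U W by (simp add: finite_measure_Diff)
  also have "\<dots> < e" using U W by simp
  finally have "\<mu> (U - ?C) < e" .
  moreover have "closedin T ?C" using W(1)
    by (simp add: closedin_def topspace_eq_carrier Diff_Diff_Int inf.absorb2 openin_subset
        flip: topspace_eq_carrier)
  moreover have "?C \<subseteq> A" using W(2) by auto
  ultimately show thesis using that U by blast
qed

text \<open>Multiplication sends the compact box \<open>{\<one>} \<times> C\<close> into
  \<open>U\<close>, so Wallace's theorem thickens it to an open box that multiplication still sends
  into \<open>U\<close>.\<close>

lemma open_nbhd_translate_subset: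
  assumes C: "closedin T C" and U: "openin T U" and sub: "C \<subseteq> U"
  shows "\<exists>V. openin T V \<and> \<one> \<in> V \<and> (\<forall>v\<in>V. v <# C \<subseteq> U)"
proof -
  let ?W = "{z \<in> topspace (prod_topology T T). (\<lambda>(x, y). x \<otimes> y) z \<in> U}"
  have Csub: "C \<subseteq> carrier G" using C closedin_subset topspace_eq_carrier by blast
  have "compactin T {\<one>}" by (simp add: topspace_eq_carrier)
  moreover have "compactin T C" using C compact closedin_compact_space by blast
  moreover have "openin (prod_topology T T) ?W"
    using continuous_map_mult U by (rule openin_continuous_map_preimage)
  moreover have "{\<one>} \<times> C \<subseteq> ?W" using sub Csub by (auto simp: topspace_eq_carrier subset_iff)
  ultimately obtain V V' where V: "openin T V" "openin T V'" "{\<one>} \<subseteq> V" "C \<subseteq> V'" "V \<times> V' \<subseteq> ?W"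
    by (rule Wallace_theorem_prod_topology)
  have "v <# C \<subseteq> U" if "v \<in> V" for v
    using V that by (fastforce simp: l_coset_def)
  with V show ?thesis by (intro exI [of _ V]) simp
qed

lemma measure_translate_Diff_less:
  assumes A: "A \<in> sets (completion M)" and e: "e > 0"
  shows "\<exists>V. openin T V \<and> \<one> \<in> V \<and> (\<forall>v\<in>V. \<mu> (A - (v <# A)) < e \<and> \<mu> ((v <# A) - A) < e)"
proof -
  \<comment> \<open>\<open>U - C\<close> is charged twice below, once as it stands and once
    translated, hence \<open>e/2\<close>.\<close>
  obtain C U where CU: "closedin T C" "openin T U" "C \<subseteq> A" "A \<subseteq> U" "\<mu> (U - C) < e/2"
    using closed_open_approx [OF A, of "e/2"] e by auto
  then obtain V where V: "openin T V" "\<one> \<in> V" "\<And>v. v \<in> V \<Longrightarrow> v <# C \<subseteq> U"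
    using open_nbhd_translate_subset [of C U] by blast
  have sets: "U \<in> sets (completion M)" "C \<in> sets (completion M)"
    using CU openin_sets closedin_sets by auto
  have main: "\<mu> ((v <# A) - A) < e" if "v \<in> V" for v
  proof -
    have v: "v \<in> carrier G" using that V(1) openin_subset topspace_eq_carrier by blast
    \<comment> \<open>For \<open>a\<close> in \<open>C\<close> the point
      \<open>v \<otimes> a\<close> stays in \<open>U\<close>, and being outside \<open>A\<close> it
      is outside \<open>C\<close>; for \<open>a\<close> outside \<open>C\<close> it lies in the
      translate of \<open>U - C\<close>.\<close>
    have "(v <# A) - A \<subseteq> (v <# (U - C)) \<union> (U - C)"
    proof
      fix y assume y: "y \<in> (v <# A) - A"
      then obtain a where a: "a \<in> A" "y = v \<otimes> a" by (auto simp: l_coset_def)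
      show "y \<in> (v <# (U - C)) \<union> (U - C)"
      proof (cases "a \<in> C")
        case True
        then have "y \<in> v <# C" using a by (auto simp: l_coset_def)
        then show ?thesis using V(3) [OF that] CU(3) y by blast
      next
        case False
        then show ?thesis using a CU(4) by (auto simp: l_coset_def)
      qed
    qed
    then have "\<mu> ((v <# A) - A) \<le> \<mu> ((v <# (U - C)) \<union> (U - C))"
      using sets v by (intro finite_measure_mono) (auto intro: l_coset_sets_completion)
    also have "\<dots> \<le> \<mu> (v <# (U - C)) + \<mu> (U - C)"
      using sets v by (intro measure_Un_le) (auto intro: l_coset_sets_completion)
    also have "\<dots> = \<mu> (U - C) + \<mu> (U - C)"
      using sets v by (simp add: measure_l_coset)
    also have "\<dots> < e" using CU by simp
    finally show ?thesis .
  qed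
  \<comment> \<open>\<open>A\<close> and \<open>v <# A\<close> have equal measure, hence so do their
    two differences.\<close>
  have "\<mu> (A - (v <# A)) < e" if "v \<in> V" for v
  proof -
    have v: "v \<in> carrier G" using that V(1) openin_subset topspace_eq_carrier by blast
    note vA = l_coset_sets_completion [OF v A]
    have "\<mu> (A - (v <# A)) = \<mu> A - \<mu> (A \<inter> (v <# A))"
      using A vA by (simp add: finite_measure_Diff')
    also have "\<dots> = \<mu> (v <# A) - \<mu> ((v <# A) \<inter> A)"
      using A v by (simp add: measure_l_coset Int_commute)
    also have "\<dots> = \<mu> ((v <# A) - A)"
      using A vA by (simp add: finite_measure_Diff')
    finally show ?thesis using main [OF that] by simp
  qed
  with V main show ?thesis by blast
qed

section \<open>Inverse sets and the averaging inequality\<close>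

lemma set_inv_eq_vimage:
  assumes "A \<subseteq> carrier G"
  shows "set_inv A = {x \<in> carrier G. inv x \<in> A}"
proof -
  have "x \<in> set_inv A" if "x \<in> carrier G" "inv x \<in> A" for x
    using that inv_inv [of x] unfolding SET_INV_def by fastforce
  then show ?thesis using assms by (auto simp: SET_INV_def subset_iff)
qed

lemma closedin_set_inv:
  assumes "closedin T C"
  shows "closedin T (set_inv C)"
  using closedin_continuous_map_preimage [OF continuous_map_inv assms]
    closedin_subset [OF assms]
  by (simp add: set_inv_eq_vimage topspace_eq_carrier)

lemma set_inv_set_inv:
  "A \<subseteq> carrier G \<Longrightarrow> set_inv (set_inv A) = A"
  by (auto simp: set_inv_eq_vimage)

text \<open>
  Since the product topology may have more Borel sets than the product \<open>\<sigma>\<close>-algebra, Tonelli's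
  theorem is not available for \<open>(x, y) \<mapsto> indicator U (inv x \<otimes> y)\<close>. A partition of the group into
  finitely many pieces, each contained in a translate \<open>p \<otimes> V\<close> of a small neighbourhood \<open>V\<close> of
  the identity, replaces the integral over \<open>x\<close> by a finite sum.
\<close>

lemma measure_mult_set_inv_le:
  assumes C: "closedin T C" and U: "openin T U" and CU: "C \<subseteq> U"
    and B: "B \<in> sets (completion M)"
    and d: "\<And>p. p \<in> carrier G \<Longrightarrow> \<mu> (B \<inter> (p <# U)) \<le> d"
  shows "\<mu> B * \<mu> (set_inv C) \<le> d"
proof -
  obtain V where V: "openin T V" "\<one> \<in> V" "\<And>v. v \<in> V \<Longrightarrow> v <# C \<subseteq> U"
    using open_nbhd_translate_subset [OF C U CU] by blast
  have Vsub: "V \<subseteq> carrier G" and Csub: "C \<subseteq> carrier G"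
    using openin_subset [OF V(1)] closedin_subset [OF C] by (simp_all add: topspace_eq_carrier)
  have "carrier G \<subseteq> (\<Union>p \<in> carrier G. p <# V)"
    using V(2) by (force simp: l_coset_def)
  then have "\<exists>\<F>. finite \<F> \<and> \<F> \<subseteq> (\<lambda>p. p <# V) ` carrier G \<and> carrier G \<subseteq> \<Union>\<F>"
    using compact V(1) openin_l_coset
    by (intro compactinD [of T]) (auto simp: compact_space_def topspace_eq_carrier)
  then obtain F where F: "finite F" "F \<subseteq> carrier G" "carrier G \<subseteq> (\<Union>p \<in> F. p <# V)"
    by (metis finite_subset_image)
  \<comment> \<open>The finite cover is numbered so that \<open>disjointed\<close> can remove from
    each translate those of smaller index.\<close>
  obtain h where h: "bij_betw h {0..<card F} F"
    using ex_bij_betw_nat_finite [OF F(1)] by blast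
  define I where "I = {0..<card F}"
  define P where "P = disjointed (\<lambda>i. h i <# V)"
  have I: "finite I" by (simp add: I_def)
  have hI_eq: "h ` I = F"
    using bij_betw_imp_surj_on [OF h] by (simp add: I_def)
  then have hI: "h i \<in> carrier G" if "i \<in> I" for i
    using that F(2) by auto
  have P_sub: "P i \<subseteq> h i <# V" for i
    by (auto simp: P_def disjointed_def)
  have P_sets: "P i \<in> sets (completion M)" if "i \<in> I" for i
    unfolding P_def disjointed_def
  proof (intro sets.Diff sets.finite_UN)
    show "h i <# V \<in> sets (completion M)"
      using hI [OF that] V(1) by (simp add: openin_l_coset openin_sets)
    \<comment> \<open>Values of \<open>h\<close> at \<open>card F\<close> and beyond are
      unspecified, but every \<open>j\<close> below \<open>i\<close> is again an index in
      \<open>I\<close>.\<close>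
    show "h j <# V \<in> sets (completion M)" if "j \<in> {0..<i}" for j
      using hI [of j] that \<open>i \<in> I\<close> V(1) by (simp add: openin_l_coset openin_sets I_def)
  qed simp
  have P_disj: "disjoint_family_on P I"
    using disjoint_family_disjointed [of "\<lambda>i. h i <# V"]
    by (auto simp: P_def disjoint_family_on_def)
  have P_Un: "(\<Union>i \<in> I. P i) = carrier G"
  proof -
    have "(\<Union>i \<in> I. P i) = (\<Union>i \<in> I. h i <# V)"
      unfolding P_def I_def by (rule finite_UN_disjointed_eq)
    also have "\<dots> = (\<Union>p \<in> F. p <# V)"
      by (simp flip: hI_eq)
    also have "\<dots> = carrier G"
      using F Vsub by (auto simp: l_coset_def subset_iff)
    finally show ?thesis .
  qed
  have hU: "h i <# U \<in> sets (completion M)" if "i \<in> I" for i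
    using hI [OF that] U by (simp add: openin_l_coset openin_sets)
  have inv_sets: "set_inv C \<in> sets (completion M)"
    using closedin_sets [OF closedin_set_inv [OF C]] by simp
  \<comment> \<open>By left invariance \<open>set_inv C\<close> may be replaced by
    \<open>y <# set_inv C\<close>, which the pieces \<open>P i\<close> cut up. A piece meeting it
    gives \<open>h i \<otimes> v = y \<otimes> inv c\<close>, so
    \<open>y = h i \<otimes> (v \<otimes> c)\<close> lies in \<open>h i <# U\<close> because
    \<open>v <# C \<subseteq> U\<close>.\<close>
  have ptwise: "\<mu> (set_inv C) \<le> (\<Sum>i\<in>I. \<mu> (P i) * indicator (h i <# U) y)"
    if y: "y \<in> carrier G" for y
  proof -
    let ?D = "y <# set_inv C"
    have D: "?D \<in> sets (completion M)" using l_coset_sets_completion [OF y inv_sets] .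
    have "\<mu> (set_inv C) = \<mu> ?D" using measure_l_coset [OF y inv_sets] by simp
    also have "?D = (\<Union>i\<in>I. P i \<inter> ?D)" using P_Un sets_subset_carrier [OF D] by blast
    also have "\<mu> \<dots> = (\<Sum>i\<in>I. \<mu> (P i \<inter> ?D))"
      using I P_sets D P_disj
      by (intro finite_measure_finite_Union) (auto simp: disjoint_family_on_def)
    also have "\<dots> \<le> (\<Sum>i\<in>I. \<mu> (P i) * indicator (h i <# U) y)"
    proof (rule sum_mono)
      fix i assume i: "i \<in> I"
      show "\<mu> (P i \<inter> ?D) \<le> \<mu> (P i) * indicator (h i <# U) y"
      proof (cases "P i \<inter> ?D = {}")
        case False
        then obtain x where x: "x \<in> P i" "x \<in> ?D" by blast
        then obtain v c where v: "v \<in> V" "x = h i \<otimes> v" and c: "c \<in> C" "x = y \<otimes> inv c"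
          using P_sub by (fastforce simp: l_coset_def SET_INV_def)
        have "y = x \<otimes> c" using c y Csub by (auto simp: m_assoc subset_iff)
        also have "\<dots> = h i \<otimes> (v \<otimes> c)"
          using v c hI [OF i] Vsub Csub by (auto simp: m_assoc subset_iff)
        finally have "y \<in> h i <# U"
          using V(3) [OF v(1)] c(1) by (auto simp: l_coset_def)
        then show ?thesis
          using P_sets [OF i] by (simp add: finite_measure_mono)
      qed simp
    qed
    finally show ?thesis .
  qed
  \<comment> \<open>Integrals of indicators come out as measures of intersections with
    \<open>space M\<close>; taking \<open>D\<close> to be \<open>UNIV\<close> covers
    \<open>B\<close> alone.\<close>
  have B_space: "B \<inter> D \<inter> space M = B \<inter> D" for D
    using sets_subset_carrier [OF B] by (auto simp: space_M)
  \<comment> \<open>Integrating \<open>ptwise\<close> over \<open>B\<close> gives an average of the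
    numbers \<open>\<mu> (B \<inter> (h i <# U))\<close> with weights \<open>\<mu> (P i)\<close> of
    total 1, each number being at most \<open>d\<close>.\<close>
  have "\<mu> B * \<mu> (set_inv C) = (\<integral>y. \<mu> (set_inv C) * indicator B y \<partial>completion M)"
    using B_space [of UNIV] by simp
  also have "\<dots> \<le> (\<integral>y. (\<Sum>i\<in>I. \<mu> (P i) * indicator (B \<inter> (h i <# U)) y) \<partial>completion M)"
  proof (rule integral_mono)
    fix y assume "y \<in> space (completion M)"
    then show "\<mu> (set_inv C) * indicator B y \<le> (\<Sum>i\<in>I. \<mu> (P i) * indicator (B \<inter> (h i <# U)) y)"
      using ptwise [of y] by (cases "y \<in> B") (simp_all add: space_M indicator_inter_arith)
  qed (use B hU in \<open>auto intro!: integrable_real_indicator simp: emeasure_eq_measure\<close>)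
  also have "\<dots> = (\<Sum>i\<in>I. \<mu> (P i) * \<mu> (B \<inter> (h i <# U)))"
    using B hU by (subst Bochner_Integration.integral_sum)
      (auto intro!: sum.cong integrable_real_indicator simp: emeasure_eq_measure B_space)
  also have "\<dots> \<le> (\<Sum>i\<in>I. \<mu> (P i) * d)"
    using d hI by (intro sum_mono mult_left_mono) auto
  also have "\<dots> = \<mu> (\<Union>i\<in>I. P i) * d"
    using I P_sets P_disj
    by (subst finite_measure_finite_Union) (auto simp: sum_distrib_right)
  also have "\<dots> = d" by (simp add: P_Un measure_space_1)
  finally show ?thesis .
qed

text \<open>A stand-in for inversion invariance, which is not part of the definition of Haar
  measure. The averaging bound is used with the whole group as \<open>B\<close> and
  \<open>set_inv C\<close> as the closed set; inverting twice returns \<open>C\<close>.\<close>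

lemma measure_le_measure_set_inv:
  assumes C: "closedin T C"
  shows "\<mu> C \<le> \<mu> (set_inv C)"
proof (rule field_le_epsilon)
  fix e :: real assume "e > 0"
  note C' = closedin_set_inv [OF C]
  have "set_inv C \<in> sets (completion M)" using closedin_sets [OF C'] by simp
  from outer_regular [OF this \<open>e > 0\<close>]
  obtain U where U: "openin T U" "set_inv C \<subseteq> U" "\<mu> U < \<mu> (set_inv C) + e" .
  have Us: "U \<in> sets (completion M)" using openin_sets [OF U(1)] by simp
  \<comment> \<open>All translates \<open>p <# U\<close> have the measure of \<open>U\<close>, so
    \<open>\<mu> U\<close> serves as \<open>d\<close>.\<close>
  have "\<mu> (carrier G) * \<mu> (set_inv (set_inv C)) \<le> \<mu> U"
  proof (rule measure_mult_set_inv_le [OF C' U(1,2)])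
    show "carrier G \<in> sets (completion M)"
      using sets.top [of "completion M"] by (simp add: space_M)
    show "\<mu> (carrier G \<inter> (p <# U)) \<le> \<mu> U" if "p \<in> carrier G" for p
      using that Us sets_subset_carrier [OF l_coset_sets_completion [OF that Us]]
      by (simp add: measure_l_coset inf.absorb2)
  qed
  then have "\<mu> C \<le> \<mu> U"
    using closedin_subset [OF C] by (simp add: set_inv_set_inv measure_space_1 topspace_eq_carrier)
  then show "\<mu> C \<le> \<mu> (set_inv C) + e" using U(3) by simp
qed

section \<open>Non-vanishing of the intersections\<close>

text \<open>If every translate of \<open>A\<close> met \<open>B\<close> in a null set, translates of
  an open \<open>U\<close> around \<open>A\<close> would meet \<open>B\<close> in measure at most
  that of \<open>U - C\<close>, with \<open>C\<close> closed inside \<open>A\<close>. This is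
  arbitrarily small, so the averaging bound would force \<open>\<mu> B * \<mu> A\<close> to
  vanish.\<close>

lemma exists_translate_Int_pos:
  assumes A: "A \<in> sets (completion M)" "\<mu> A > 0" and B: "B \<in> sets (completion M)" "\<mu> B > 0"
  shows "\<exists>x \<in> carrier G. \<mu> (B \<inter> (x <# A)) > 0"
proof (rule ccontr)
  assume "\<not> ?thesis"
  then have zero: "\<mu> (B \<inter> (x <# A)) = 0" if "x \<in> carrier G" for x
    using that by (metis measure_nonneg order_le_less)
  \<comment> \<open>The error \<open>e/2\<close> made in replacing \<open>\<mu> A\<close> by
    \<open>\<mu> C\<close> thus stays at most \<open>e/2\<close> after multiplication by
    \<open>\<mu> B\<close>.\<close>
  have B1: "\<mu> B \<le> 1"
    using bounded_measure [of B] measure_space_1 by (simp add: space_M)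
  have "\<mu> B * \<mu> A \<le> 0"
  proof (rule field_le_epsilon)
    fix e :: real assume e: "e > 0"
    obtain C U where CU: "closedin T C" "openin T U" "C \<subseteq> A" "A \<subseteq> U" "\<mu> (U - C) < e/2"
      using closed_open_approx [OF A(1), of "e/2"] e by auto
    have sets: "U \<in> sets (completion M)" "C \<in> sets (completion M)"
      using CU openin_sets closedin_sets by auto
    have "\<mu> B * \<mu> (set_inv C) \<le> \<mu> (U - C)"
    proof (rule measure_mult_set_inv_le [OF CU(1,2) _ B(1)])
      fix p assume p: "p \<in> carrier G"
      have "B \<inter> (p <# U) \<subseteq> (B \<inter> (p <# A)) \<union> (p <# (U - C))"
        using CU(3) by (auto simp: l_coset_def)
      then have "\<mu> (B \<inter> (p <# U)) \<le> \<mu> ((B \<inter> (p <# A)) \<union> (p <# (U - C)))"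
        using A B sets p by (intro finite_measure_mono) (auto intro: l_coset_sets_completion)
      also have "\<dots> \<le> \<mu> (B \<inter> (p <# A)) + \<mu> (p <# (U - C))"
        using A B sets p by (intro measure_Un_le) (auto intro: l_coset_sets_completion)
      also have "\<dots> = \<mu> (U - C)" using zero p sets by (simp add: measure_l_coset)
      finally show "\<mu> (B \<inter> (p <# U)) \<le> \<mu> (U - C)" .
    qed (use CU in auto)
    then have BC: "\<mu> B * \<mu> C \<le> e/2"
      using mult_left_mono [OF measure_le_measure_set_inv [OF CU(1)], of "\<mu> B"] CU(5) by simp
    have "\<mu> A \<le> \<mu> (C \<union> (U - C))" using sets CU by (intro finite_measure_mono) auto
    also have "\<dots> \<le> \<mu> C + \<mu> (U - C)" using sets by (intro measure_Un_le) auto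
    finally have "\<mu> A \<le> \<mu> C + e/2" using CU(5) by simp
    then have "\<mu> B * \<mu> A \<le> \<mu> B * \<mu> C + \<mu> B * (e/2)"
      using mult_left_mono [of "\<mu> A" "\<mu> C + e/2" "\<mu> B"] by (simp add: distrib_left)
    also have "\<mu> B * (e/2) \<le> e/2" using B1 e mult_right_mono [of "\<mu> B" 1 "e/2"] by simp
    finally show "\<mu> B * \<mu> A \<le> 0 + e" using BC by simp
  qed
  then show False using mult_pos_pos [OF B(2) A(2)] by linarith
qed

lemma sets_INT_l_coset:
  assumes "finite I" "I \<noteq> {}" "\<And>i. i \<in> I \<Longrightarrow> x i \<in> carrier G"
    "\<And>i. i \<in> I \<Longrightarrow> A i \<in> sets (completion M)"
  shows "(\<Inter>i\<in>I. x i <# A i) \<in> sets (completion M)"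
  using assms by (intro sets.finite_INT) (auto intro: l_coset_sets_completion)

text \<open>Induction on the index set: the intersection already made positive plays the role of
  \<open>B\<close> for the next set. The witness is extensional because such functions are the
  points of the product topology.\<close>

lemma exists_translates_INT_pos:
  assumes "finite I" "I \<noteq> {}"
    and "\<And>i. i \<in> I \<Longrightarrow> A i \<in> sets (completion M)" "\<And>i. i \<in> I \<Longrightarrow> \<mu> (A i) > 0"
  shows "\<exists>x \<in> I \<rightarrow>\<^sub>E carrier G. \<mu> (\<Inter>i\<in>I. x i <# A i) > 0"
  using assms
proof (induction I rule: finite_ne_induct)
  case (singleton i)
  let ?x = "\<lambda>j\<in>{i}. \<one>"
  have "\<mu> (\<Inter>j\<in>{i}. ?x j <# A j) = \<mu> (A i)"
    using singleton by (simp add: measure_l_coset)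
  moreover have "?x \<in> {i} \<rightarrow>\<^sub>E carrier G" by auto
  ultimately show ?case using singleton by (metis singletonI)
next
  case (insert i I)
  then obtain x where x: "x \<in> I \<rightarrow>\<^sub>E carrier G" "\<mu> (\<Inter>j\<in>I. x j <# A j) > 0" by auto
  then obtain p where p: "p \<in> carrier G" "\<mu> ((\<Inter>j\<in>I. x j <# A j) \<inter> (p <# A i)) > 0"
    using exists_translate_Int_pos [of "A i" "\<Inter>j\<in>I. x j <# A j"] sets_INT_l_coset [of I x A] insert
    by (auto simp: PiE_iff)
  let ?x = "x(i := p)"
  have "?x j = x j" if "j \<in> I" for j
    using that insert.hyps by auto
  then have "(\<Inter>j\<in>insert i I. ?x j <# A j) = (\<Inter>j\<in>I. x j <# A j) \<inter> (p <# A i)"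
    by auto
  moreover have "?x \<in> insert i I \<rightarrow>\<^sub>E carrier G"
    using x(1) p(1) by (rule PiE_fun_upd [rotated])
  ultimately show ?case using p(2) by (intro bexI [of _ ?x]) simp_all
qed

section \<open>Continuity of the intersection measure\<close>

lemma l_coset_Diff:
  assumes "x \<in> carrier G" "A \<subseteq> carrier G" "B \<subseteq> carrier G"
  shows "x <# (A - B) = (x <# A) - (x <# B)"
proof -
  have "A - B \<subseteq> carrier G" using assms by blast
  then show ?thesis using assms by (auto simp: l_coset_eq_vimage)
qed

text \<open>A point of all \<open>E i\<close> that misses some \<open>F i\<close> lies in
  \<open>E i - F i\<close>, so the first intersection is covered by the second together with these
  differences.\<close>

lemma measure_INT_le:
  assumes "finite I" "I \<noteq> {}" "\<And>i. i \<in> I \<Longrightarrow> E i \<in> sets (completion M)"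
    "\<And>i. i \<in> I \<Longrightarrow> F i \<in> sets (completion M)"
  shows "\<mu> (\<Inter>i\<in>I. E i) \<le> \<mu> (\<Inter>i\<in>I. F i) + (\<Sum>i\<in>I. \<mu> (E i - F i))"
proof -
  have F: "(\<Inter>i\<in>I. F i) \<in> sets (completion M)" using assms by (intro sets.finite_INT) auto
  have D: "(\<Union>i\<in>I. E i - F i) \<in> sets (completion M)" using assms by auto
  have "\<mu> (\<Inter>i\<in>I. E i) \<le> \<mu> ((\<Inter>i\<in>I. F i) \<union> (\<Union>i\<in>I. E i - F i))"
    using F D by (intro finite_measure_mono) auto
  also have "\<dots> \<le> \<mu> (\<Inter>i\<in>I. F i) + \<mu> (\<Union>i\<in>I. E i - F i)"
    using F D by (intro measure_Un_le) auto
  also have "\<mu> (\<Union>i\<in>I. E i - F i) \<le> (\<Sum>i\<in>I. \<mu> (E i - F i))"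
    using assms by (intro finite_measure_subadditive_finite) auto
  finally show ?thesis by simp
qed

text \<open>With \<open>y i = x i \<otimes> v\<close>, left invariance reduces the comparison of
  \<open>x i <# A i\<close> with \<open>y i <# A i\<close> to that of \<open>A i\<close> with
  \<open>v <# A i\<close> for \<open>v\<close> near the identity.\<close>

lemma continuous_map_measure_INT:
  assumes I: "finite I" "I \<noteq> {}" and A: "\<And>i. i \<in> I \<Longrightarrow> A i \<in> sets (completion M)"
  shows "continuous_map (product_topology (\<lambda>_. T) I) euclideanreal
    (\<lambda>x. \<mu> (\<Inter>i\<in>I. x i <# A i))"
proof -
  have "\<exists>U. openin (product_topology (\<lambda>_. T) I) U \<and> x \<in> U \<and>
      (\<forall>y\<in>U. \<mu> (\<Inter>i\<in>I. y i <# A i) \<in> Met_TC.mball (\<mu> (\<Inter>i\<in>I. x i <# A i)) e)"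
    if "x \<in> topspace (product_topology (\<lambda>_. T) I)" and e: "e > 0" for x e
  proof -
    have x: "x \<in> I \<rightarrow>\<^sub>E carrier G" using that by (simp add: topspace_eq_carrier)
    \<comment> \<open>Each of the \<open>card I\<close> factors contributes an error below
      \<open>d\<close>, for a total below \<open>e\<close>.\<close>
    define d where "d = e / card I"
    have d: "d > 0" using I e by (simp add: d_def card_gt_0_iff)
    have "\<exists>V. openin T V \<and> \<one> \<in> V \<and>
        (\<forall>v\<in>V. \<mu> (A i - (v <# A i)) < d \<and> \<mu> ((v <# A i) - A i) < d)" if "i \<in> I" for i
      using measure_translate_Diff_less [OF A [OF that] d] .
    then obtain V where V: "\<And>i. i \<in> I \<Longrightarrow> openin T (V i)" "\<And>i. i \<in> I \<Longrightarrow> \<one> \<in> V i"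
      "\<And>i v. i \<in> I \<Longrightarrow> v \<in> V i \<Longrightarrow> \<mu> (A i - (v <# A i)) < d"
      "\<And>i v. i \<in> I \<Longrightarrow> v \<in> V i \<Longrightarrow> \<mu> ((v <# A i) - A i) < d"
      by metis
    let ?U = "\<Pi>\<^sub>E i\<in>I. x i <# V i"
    have "openin (product_topology (\<lambda>_. T) I) ?U"
      using I x V(1) by (auto simp: openin_PiE PiE_iff intro!: openin_l_coset)
    moreover have "x \<in> ?U"
      using x V(2) by (force simp: PiE_iff l_coset_def)
    moreover have "\<bar>\<mu> (\<Inter>i\<in>I. x i <# A i) - \<mu> (\<Inter>i\<in>I. y i <# A i)\<bar> < e" if y: "y \<in> ?U" for y
    proof -
      have step: "x i <# A i \<in> sets (completion M) \<and> y i <# A i \<in> sets (completion M) \<and>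
          \<mu> ((x i <# A i) - (y i <# A i)) < d \<and> \<mu> ((y i <# A i) - (x i <# A i)) < d"
        if i: "i \<in> I" for i
      proof -
        obtain v where v: "v \<in> V i" "y i = x i \<otimes> v"
          using y i by (auto simp: PiE_iff l_coset_def)
        have xi: "x i \<in> carrier G" using x i by auto
        have vc: "v \<in> carrier G" using v V(1) [OF i] openin_subset topspace_eq_carrier by blast
        note Ac = sets_subset_carrier [OF A [OF i]]
        note vA = l_coset_sets_completion [OF vc A [OF i]]
        note vAc = sets_subset_carrier [OF vA]
        have yA: "y i <# A i = x i <# (v <# A i)" using v xi vc Ac by (simp add: l_coset_l_coset)
        have "(x i <# A i) - (y i <# A i) = x i <# (A i - (v <# A i))"
          "(y i <# A i) - (x i <# A i) = x i <# ((v <# A i) - A i)"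
          using xi Ac vAc by (simp_all add: yA l_coset_Diff)
        then show ?thesis
          using V(3,4) [OF i v(1)] A [OF i] vA xi
          by (simp add: measure_l_coset yA l_coset_sets_completion)
      qed
      \<comment> \<open>Both directions are recorded, since the absolute difference has to be
        bounded.\<close>
      have "\<mu> (\<Inter>i\<in>I. x i <# A i) \<le> \<mu> (\<Inter>i\<in>I. y i <# A i) + (\<Sum>i\<in>I. \<mu> ((x i <# A i) - (y i <# A i)))"
        "\<mu> (\<Inter>i\<in>I. y i <# A i) \<le> \<mu> (\<Inter>i\<in>I. x i <# A i) + (\<Sum>i\<in>I. \<mu> ((y i <# A i) - (x i <# A i)))"
        using I step by (intro measure_INT_le; blast)+
      moreover have "(\<Sum>i\<in>I. \<mu> ((x i <# A i) - (y i <# A i))) < (\<Sum>i\<in>I. d)"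
        "(\<Sum>i\<in>I. \<mu> ((y i <# A i) - (x i <# A i))) < (\<Sum>i\<in>I. d)"
        using I step by (intro sum_strict_mono; blast)+
      moreover have "(\<Sum>i\<in>I. d) = e" using I by (simp add: d_def)
      ultimately show ?thesis by linarith
    qed
    ultimately show ?thesis by (intro exI [of _ ?U]) (auto simp: dist_real_def)
  qed
  then show ?thesis
    using Met_TC.continuous_map_to_metric [where 'a=real] by (simp only: mtopology_is_euclidean) blast
qed

section \<open>Recurrence near the identity\<close>

text \<open>Near the identity each \<open>u i <# A\<close> misses less than
  \<open>\<mu> A / card I\<close> of \<open>A\<close>, so all of them together miss less than the
  whole of \<open>A\<close>.\<close>

lemma recurrence_nbhd:
  assumes A: "A \<in> sets (completion M)" "\<mu> A > 0" and I: "finite I" "I \<noteq> {}"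
  shows "\<exists>U. openin T U \<and> \<one> \<in> U \<and>
    (\<forall>u. (\<forall>i\<in>I. u i \<in> U) \<longrightarrow> \<mu> (A \<inter> (\<Inter>i\<in>I. u i <# A)) > 0)"
proof -
  have c: "card I > 0" using I by (simp add: card_gt_0_iff)
  have "\<mu> A / card I > 0" using A(2) c by simp
  then obtain V where V: "openin T V" "\<one> \<in> V" "\<And>v. v \<in> V \<Longrightarrow> \<mu> (A - (v <# A)) < \<mu> A / card I"
    using measure_translate_Diff_less [OF A(1), of "\<mu> A / card I"] by blast
  have "\<mu> (A \<inter> (\<Inter>i\<in>I. u i <# A)) > 0" if u: "\<forall>i\<in>I. u i \<in> V" for u
  proof -
    have uA: "u i <# A \<in> sets (completion M)" if "i \<in> I" for i
      using u that V(1) openin_subset topspace_eq_carrier A(1)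
      by (intro l_coset_sets_completion) blast+
    \<comment> \<open>The family \<open>E\<close> of \<open>measure_INT_le\<close> is constantly
      \<open>A\<close>; its intersection is \<open>A\<close> because \<open>I\<close> is
      non-empty.\<close>
    have "\<mu> (\<Inter>i\<in>I. A) \<le> \<mu> (\<Inter>i\<in>I. A \<inter> (u i <# A)) + (\<Sum>i\<in>I. \<mu> (A - A \<inter> (u i <# A)))"
      using I A uA by (intro measure_INT_le) auto
    also have "(\<Sum>i\<in>I. \<mu> (A - A \<inter> (u i <# A))) < (\<Sum>i\<in>I. \<mu> A / card I)"
      using I u V(3) by (intro sum_strict_mono) (auto simp: Diff_Int)
    also have "\<dots> = \<mu> A" using c by simp
    also have "(\<Inter>i\<in>I. A \<inter> (u i <# A)) = A \<inter> (\<Inter>i\<in>I. u i <# A)" using I by auto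
    finally show ?thesis using I by simp
  qed
  with V show ?thesis by blast
qed

end

theorem theorem2p1:
  fixes G :: "('a, 'b) monoid_scheme" and T :: "'a topology" and M :: "'a measure"
  assumes "compact_Hausdorff_group G T"
    and "normalized_haar_measure G T M"
  shows "(\<forall>(n::nat) (A :: nat \<Rightarrow> 'a set).
            n \<ge> 1 \<and>
            (\<forall>i \<in> {1..n}. A i \<in> sets (completion M) \<and> measure (completion M) (A i) > 0) \<longrightarrow>
            (let \<Lambda> = (\<lambda>x. measure (completion M) (\<Inter>i \<in> {1..n}. x i <#\<^bsub>G\<^esub> A i)) in
               (\<exists>x \<in> topspace (product_topology (\<lambda>_. T) {1..n}). \<Lambda> x \<noteq> 0) \<and>
               continuous_map (product_topology (\<lambda>_. T) {1..n}) (top_of_set {0::real..}) \<Lambda>)) \<and>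
         (\<forall>(A :: 'a set) (k::nat).
            A \<in> sets (completion M) \<and> measure (completion M) A > 0 \<and> k \<ge> 1 \<longrightarrow>
            (\<exists>U. openin T U \<and> \<one>\<^bsub>G\<^esub> \<in> U \<and>
               (\<forall>u :: nat \<Rightarrow> 'a. (\<forall>i \<in> {1..k}. u i \<in> U) \<longrightarrow>
                  measure (completion M) (A \<inter> (\<Inter>i \<in> {1..k}. u i <#\<^bsub>G\<^esub> A)) > 0)))"
proof -
  interpret normalized_haar_group G T M
    using assms by (simp add: normalized_haar_group_def normalized_haar_group_axioms_def)
  show ?thesis
  proof (intro conjI allI impI)
    fix n :: nat and A :: "nat \<Rightarrow> 'a set"
    assume *: "n \<ge> 1 \<and> (\<forall>i \<in> {1..n}. A i \<in> sets (completion M) \<and> measure (completion M) (A i) > 0)"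
    then have I: "finite {1..n}" "{1..n} \<noteq> {}" by auto
    obtain x where "x \<in> {1..n} \<rightarrow>\<^sub>E carrier G" "\<mu> (\<Inter>i\<in>{1..n}. x i <#\<^bsub>G\<^esub> A i) > 0"
      using exists_translates_INT_pos [OF I, of A] * by blast
    then have "\<exists>x \<in> topspace (product_topology (\<lambda>_. T) {1..n}). \<mu> (\<Inter>i\<in>{1..n}. x i <#\<^bsub>G\<^esub> A i) \<noteq> 0"
      by (intro bexI [of _ x]) (auto simp: topspace_eq_carrier)
    \<comment> \<open>The codomain shrinks from the real line to the non-negative reals because
      measures are non-negative.\<close>
    moreover have "continuous_map (product_topology (\<lambda>_. T) {1..n}) (top_of_set {0::real..})
        (\<lambda>x. \<mu> (\<Inter>i\<in>{1..n}. x i <#\<^bsub>G\<^esub> A i))"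
      using continuous_map_measure_INT [OF I, of A] *
      by (auto simp: continuous_map_in_subtopology)
    ultimately show "let \<Lambda> = (\<lambda>x. \<mu> (\<Inter>i \<in> {1..n}. x i <#\<^bsub>G\<^esub> A i)) in
        (\<exists>x \<in> topspace (product_topology (\<lambda>_. T) {1..n}). \<Lambda> x \<noteq> 0) \<and>
        continuous_map (product_topology (\<lambda>_. T) {1..n}) (top_of_set {0::real..}) \<Lambda>"
      by (simp add: Let_def)
  next
    fix A :: "'a set" and k :: nat
    assume "A \<in> sets (completion M) \<and> measure (completion M) A > 0 \<and> k \<ge> 1"
    then show "\<exists>U. openin T U \<and> \<one>\<^bsub>G\<^esub> \<in> U \<and>
        (\<forall>u :: nat \<Rightarrow> 'a. (\<forall>i \<in> {1..k}. u i \<in> U) \<longrightarrow>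
          measure (completion M) (A \<inter> (\<Inter>i \<in> {1..k}. u i <#\<^bsub>G\<^esub> A)) > 0)"
      by (intro recurrence_nbhd) auto
  qed
qed

end
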